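(* Consider the initial value problem $\dot y(x)=f(x,y(x))$, $x\in[x_0,x_f]$, $y(x_0)=y^0\in\mathbb{R}^N$, with $f=(f^1,\dots,f^N)$ satisfying the assumptions listed in the context, and let $y$ be its unique solution on $[x_0,x_f]$. Fix $m\ge 1$ and reference nodes $\xi_1<\xi_2<\dots<\xi_m$ in $[a,b]$. For $M\in\mathbb{N}^*$ put $h=\frac{x_f-x_0}{M}$ and let $u_0,u_1,\dots,u_M$ be produced by the numerical Picard iterations with fixed reference set described in the context (in either of the two variants for defining $x_{i+1}$ and $u_{i+1}$), where on the $i$-th interval $n_i\ge 1$ iterations are performed (the number $n_i$ may depend on $i$). Let $e_i=\|y(x_i)-u_i\|$. If $h\tilde L\tilde w<1$, then $$ \max_{1\le i\le M}e_i\ \le\ e^{(x_f-x_0)\tilde L\tilde w\left(1+\frac{1}{1-h\tilde L\tilde w}\right)}\;\frac{h\tilde L\tilde wK+\dfrac{K_m^*h^m}{m!\,(1-h\tilde L\tilde w)}}{\tilde L\tilde w+\dfrac{\tilde L\tilde w}{1-h\tilde L\tilde w}} . $$ Consequently $\max_{1\le i\le M}e_i\to 0$ as $h\searrow 0$ (equivalently, as $M\to\infty$), i.e. the method converges.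
   Context: Norm: for $y=(y^1,\dots,y^N)\in\mathbb{R}^N$, $\|y\|=\max_{1\le j\le N}|y^j|$. Assumptions on $f:[x_0,x_f]\times\mathbb{R}^N\to\mathbb{R}^N$: $f$ is continuous and there is $L>0$ with $|f^\mu(x,y_1)-f^\mu(x,y_2)|\le L\sum_{j=1}^N|y_1^j-y_2^j|$ for all $x\in[x_0,x_f]$, $y_1,y_2\in\mathbb{R}^N$, $\mu\in\{1,\dots,N\}$. Put $\tilde L=NL$, so $\|f(x,y_1)-f(x,y_2)\|\le\tilde L\|y_1-y_2\|$. Moreover $f$ has continuous partial derivatives up to order $m$ (so $x\mapsto f(x,y(x))$ is $m$ times continuously differentiable on $[x_0,x_f]$). Here $K>0$ and $K_m^*>0$ are constants with $$\max_{1\le\mu\le N}\max_{x\in[x_0,x_f]}|f^\mu(x,y(x))|\le K,\qquad \max_{1\le\mu\le N}\max_{x\in[x_0,x_f]}\left|\frac{\mathrm{d}^m}{\mathrm{d}x^m}f^\mu(x,y(x))\right|\le K_m^*.$$ Reference quantities: $a<b$, $\tilde l_j(\xi)=\prod_{\mu\ne j}\frac{\xi-\xi_\mu}{\xi_j-\xi_\mu}$ ($1\le j\le m$) are the Lagrange fundamental polynomials of the nodes $\xi_1,\dots,\xi_m$; $w_{j,k}=\frac{1}{b-a}\int_a^{\xi_k}\tilde l_j(\xi)\,\mathrm{d}\xi$ for $1\le j,k\le m$; $$w=\max\left\{\max_{1\le j,k\le m}|w_{j,k}|,\ \max_{1\le j\le m}\frac{1}{b-a}\left|\int_a^b\tilde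 l_j(\xi)\,\mathrm{d}\xi\right|\right\},\qquad \tilde w=m\,w.$$ The method: $u_0=y^0$, starting at the point $x_0$. Given $x_i$ and $u_i$ ($0\le i\le M-1$), let $\varphi_i(\xi)=x_i+\frac{h}{b-a}(\xi-a)$ and $x_{i,j}=\varphi_i(\xi_j)$. Set $u^{(0)}_{i,k}=u_i$ and, for $n\ge 0$ and $k\in\{1,\dots,m\}$, $$u^{(n+1)}_{i,k}=u_i+h\sum_{j=1}^m w_{j,k}\,f(x_{i,j},u^{(n)}_{i,j}).$$ After $n_i$ iterations, the next mesh point and the next approximation are defined by one of the following two variants (the same variant being used for all $i$): (1) $x_{i+1}=\varphi_i(\xi_m)$ and $u_{i+1}=u^{(n_i)}_{i,m}$; (2) $x_{i+1}=\varphi_i(b)=x_i+h$ and $u_{i+1}=u_i+\frac{h}{b-a}\sum_{j=1}^m\left(\int_a^b\tilde l_j(\xi)\,\mathrm{d}\xi\right)f(x_{i,j},u^{(n_i)}_{i,j})$. *)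

theory Defs
  imports "HOL-Analysis.Analysis"
begin

text \<open>
  \<open>C_partial k S g\<close>: \<open>g\<close> has continuous partial derivatives up to order \<open>k\<close> on \<open>S\<close>.
  Difference quotients only use points of \<open>S\<close>, so the derivatives are one-sided at boundary
  points. \<open>D e\<close> is the partial derivative in the coordinate direction \<open>e\<close>; for \<open>S\<close> a strip
  \<open>{x0..xf} \<times> UNIV\<close> with \<open>x0 < xf\<close> it is uniquely determined on \<open>S\<close>.
\<close>

primrec C_partial ::
  "nat \<Rightarrow> 'a::euclidean_space set \<Rightarrow> ('a \<Rightarrow> 'b::real_normed_vector) \<Rightarrow> bool" where
  "C_partial 0 S g \<longleftrightarrow> continuous_on S g"
| "C_partial (Suc k) S g \<longleftrightarrow> continuous_on S g \<and>
     (\<exists>D. \<forall>e\<in>Basis.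
        (\<forall>p\<in>S. ((\<lambda>t. g (p + t *\<^sub>R e)) has_vector_derivative D e p)
                 (at 0 within {t. p + t *\<^sub>R e \<in> S})) \<and>
        C_partial k S (D e))"

primrec nth_deriv_on :: "real set \<Rightarrow> nat \<Rightarrow> (real \<Rightarrow> real) \<Rightarrow> real \<Rightarrow> real" where
  "nth_deriv_on S 0 g = g"
| "nth_deriv_on S (Suc n) g = (\<lambda>x. vector_derivative (nth_deriv_on S n g) (at x within S))"

text \<open>Nodes are \<open>\<xi> 1, \<dots>, \<xi> m\<close>; other values of \<open>\<xi> :: nat \<Rightarrow> real\<close> are never used.\<close>

definition lagrange_fund :: "(nat \<Rightarrow> real) \<Rightarrow> nat \<Rightarrow> nat \<Rightarrow> real \<Rightarrow> real" where
  "lagrange_fund \<xi> m j s = (\<Prod>\<mu>\<in>{1..m} - {j}. (s - \<xi> \<mu>) / (\<xi> j - \<xi> \<mu>))"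

definition node_weight :: "real \<Rightarrow> real \<Rightarrow> (nat \<Rightarrow> real) \<Rightarrow> nat \<Rightarrow> nat \<Rightarrow> nat \<Rightarrow> real" where
  "node_weight a b \<xi> m j k = 1 / (b - a) * integral {a..\<xi> k} (lagrange_fund \<xi> m j)"

definition max_weight :: "real \<Rightarrow> real \<Rightarrow> (nat \<Rightarrow> real) \<Rightarrow> nat \<Rightarrow> real" where
  "max_weight a b \<xi> m =
     max (MAX (j, k)\<in>{1..m} \<times> {1..m}. \<bar>node_weight a b \<xi> m j k\<bar>)
         (MAX j\<in>{1..m}. 1 / (b - a) * \<bar>integral {a..b} (lagrange_fund \<xi> m j)\<bar>)"

definition ref_map :: "real \<Rightarrow> real \<Rightarrow> real \<Rightarrow> real \<Rightarrow> real \<Rightarrow> real" where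
  "ref_map a b h x s = x + h / (b - a) * (s - a)"

text \<open>\<open>picard_iter f a b \<xi> m h x u n k\<close> is the \<open>n\<close>-th Picard iterate at the \<open>k\<close>-th node of the
  step that starts from the approximation \<open>u\<close> at the mesh point \<open>x\<close>.\<close>

primrec picard_iter ::
  "(real \<Rightarrow> real^'N \<Rightarrow> real^'N) \<Rightarrow> real \<Rightarrow> real \<Rightarrow> (nat \<Rightarrow> real) \<Rightarrow> nat \<Rightarrow> real
    \<Rightarrow> real \<Rightarrow> real^'N \<Rightarrow> nat \<Rightarrow> nat \<Rightarrow> real^'N" where
  "picard_iter f a b \<xi> m h x u 0 = (\<lambda>k. u)"
| "picard_iter f a b \<xi> m h x u (Suc n) =
     (\<lambda>k. u + h *\<^sub>R (\<Sum>j=1..m. node_weight a b \<xi> m j k *\<^sub>R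
                f (ref_map a b h x (\<xi> j)) (picard_iter f a b \<xi> m h x u n j)))"

datatype variant = Last_Node | Full_Step

fun picard_step ::
  "variant \<Rightarrow> (real \<Rightarrow> real^'N \<Rightarrow> real^'N) \<Rightarrow> real \<Rightarrow> real \<Rightarrow> (nat \<Rightarrow> real) \<Rightarrow> nat \<Rightarrow> real
    \<Rightarrow> nat \<Rightarrow> real \<times> (real^'N) \<Rightarrow> real \<times> (real^'N)" where
  "picard_step Last_Node f a b \<xi> m h n (x, u) =
     (ref_map a b h x (\<xi> m), picard_iter f a b \<xi> m h x u n m)"
| "picard_step Full_Step f a b \<xi> m h n (x, u) =
     (ref_map a b h x b,
      u + (h / (b - a)) *\<^sub>R (\<Sum>j=1..m. integral {a..b} (lagrange_fund \<xi> m j) *\<^sub>R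
            f (ref_map a b h x (\<xi> j)) (picard_iter f a b \<xi> m h x u n j)))"

text \<open>The sequence of pairs \<open>(x\<^sub>i, u\<^sub>i)\<close>, with \<open>n i\<close> iterations on the \<open>i\<close>-th interval.\<close>

primrec picard_method ::
  "variant \<Rightarrow> (real \<Rightarrow> real^'N \<Rightarrow> real^'N) \<Rightarrow> real \<Rightarrow> real \<Rightarrow> (nat \<Rightarrow> real) \<Rightarrow> nat \<Rightarrow> real
    \<Rightarrow> (nat \<Rightarrow> nat) \<Rightarrow> real \<Rightarrow> real^'N \<Rightarrow> nat \<Rightarrow> real \<times> (real^'N)" where
  "picard_method v f a b \<xi> m h n x0 y0 0 = (x0, y0)"
| "picard_method v f a b \<xi> m h n x0 y0 (Suc i) =
     picard_step v f a b \<xi> m h (n i) (picard_method v f a b \<xi> m h n x0 y0 i)"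

text \<open>\<open>infnorm\<close> on \<open>real^'N\<close> is the maximum norm.\<close>

definition node_error :: "(real \<Rightarrow> real^'N) \<Rightarrow> real \<times> (real^'N) \<Rightarrow> real" where
  "node_error y s = infnorm (y (fst s) - snd s)"

end

theory Submission
  imports Defs
begin

text \<open>
  The error analysis is that of a one-step method. Put \<open>\<theta> = h Lt wt\<close> and
  \<open>r = Km h ^ m / m!\<close>.
  
  Within one step the exact solution satisfies the discretised integral equation up to an error
  \<open>h r\<close> (\<open>collocation_defect\<close>): this is the integrated Lagrange interpolation error
  (\<open>lagrange_interpolation_error\<close>) of \<open>x \<mapsto> f x (y x)\<close>, a function which is \<open>m\<close> times
  differentiable by the chain rule (\<open>C_partial_along_solution\<close>). The discrete Picard operator is
  Lipschitz with constant \<open>\<theta> < 1\<close> in the maximum norm, so from the error \<open>e\<close> at the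
  beginning of the step the iterates have an error of at most
  \<open>(e + h r) / (1 - \<theta>) + \<theta> ^ n h K\<close> (\<open>picard_iter_error\<close>); here \<open>h K\<close> bounds the
  distance between the solution and the constant initial guess.
  
  Consequently the errors at the mesh points grow per step by a factor at most
  \<open>1 + \<theta> + \<theta> / (1 - \<theta>)\<close> plus the contribution \<open>h (\<theta> K + r / (1 - \<theta>))\<close>
  (\<open>picard_step_error\<close>), and a discrete Gronwall inequality (\<open>discrete_gronwall\<close>) gives the
  bound. It tends to \<open>0\<close> with \<open>h\<close>, as both terms of its numerator do, while the denominator
  tends to \<open>2 Lt wt\<close>, which is nonzero because \<open>wt \<ge> 1\<close> (\<open>wt_ge_1\<close>).
\<close>

section \<open>Continuously differentiable curves\<close>

text \<open>
  Derivatives at the end points of an interval \<open>S\<close> are one-sided. Existence of some derivative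
  \<open>g'\<close> is asserted instead of using \<open>vector_derivative\<close>, so that closure
  under algebraic operations is proved by exhibiting the expected derivative.
\<close>

primrec C_curve :: "nat \<Rightarrow> real set \<Rightarrow> (real \<Rightarrow> 'b::real_normed_vector) \<Rightarrow> bool" where
  "C_curve 0 S g \<longleftrightarrow> continuous_on S g"
| "C_curve (Suc k) S g \<longleftrightarrow>
     (\<exists>g'. (\<forall>t\<in>S. (g has_vector_derivative g' t) (at t within S)) \<and> C_curve k S g')"

lemma C_curve_Suc_imp: "C_curve (Suc k) S g \<Longrightarrow> C_curve k S g"
proof (induction k arbitrary: g)
  case 0
  then show ?case
    by (auto simp: continuous_on_eq_continuous_within intro: has_vector_derivative_continuous)
next
  case (Suc k)
  then show ?case by (metis C_curve.simps(2))
qed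

lemma C_curve_const: "C_curve k S (\<lambda>t. c)"
proof (induction k arbitrary: c)
  case (Suc k)
  have "\<forall>t\<in>S. ((\<lambda>t. c) has_vector_derivative 0) (at t within S)"
    by (auto intro: derivative_eq_intros)
  with Suc.IH[of 0] show ?case by (auto intro!: exI[of _ "\<lambda>t. 0"])
qed auto

lemma C_curve_bounded_linear:
  assumes "bounded_linear T" "C_curve k S g"
  shows "C_curve k S (\<lambda>t. T (g t))"
  using assms(2)
proof (induction k arbitrary: g)
  case 0
  then show ?case
    using assms(1) by (simp add: bounded_linear.continuous_on)
next
  case (Suc k)
  then obtain g' where "\<forall>t\<in>S. (g has_vector_derivative g' t) (at t within S)" "C_curve k S g'"
    by auto
  then show ?case
    using Suc.IH bounded_linear.has_vector_derivative[OF assms(1)] by fastforce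
qed

lemma C_curve_add: "C_curve k S f \<Longrightarrow> C_curve k S g \<Longrightarrow> C_curve k S (\<lambda>t. f t + g t)"
proof (induction k arbitrary: f g)
  case 0
  then show ?case by (auto intro: continuous_intros)
next
  case (Suc k)
  then obtain f' g' where
    "\<forall>t\<in>S. (f has_vector_derivative f' t) (at t within S)" "C_curve k S f'"
    "\<forall>t\<in>S. (g has_vector_derivative g' t) (at t within S)" "C_curve k S g'"
    by auto
  with Suc.IH[of f' g'] show ?case
    by (auto intro!: exI[of _ "\<lambda>t. f' t + g' t"] derivative_intros)
qed

lemma C_curve_sum: "(\<And>e. e \<in> B \<Longrightarrow> C_curve k S (f e)) \<Longrightarrow> C_curve k S (\<lambda>t. \<Sum>e\<in>B. f e t)"
  by (induction B rule: infinite_finite_induct) (simp_all add: C_curve_const C_curve_add)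

lemma C_curve_scaleR:
  "C_curve k S f \<Longrightarrow> C_curve k S g \<Longrightarrow> C_curve k S (\<lambda>t. f t *\<^sub>R g t)"
proof (induction k arbitrary: f g)
  case 0
  then show ?case by (auto intro: continuous_intros)
next
  case (Suc k)
  then obtain f' g' where *:
    "\<forall>t\<in>S. (f has_vector_derivative f' t) (at t within S)" "C_curve k S f'"
    "\<forall>t\<in>S. (g has_vector_derivative g' t) (at t within S)" "C_curve k S g'"
    by auto
  have "((\<lambda>t. f t *\<^sub>R g t) has_vector_derivative (f t *\<^sub>R g' t + f' t *\<^sub>R g t)) (at t within S)"
    if "t \<in> S" for t
    using *(1,3) that by (auto intro!: has_vector_derivative_scaleR
        simp: has_real_derivative_iff_has_vector_derivative)
  moreover have "C_curve k S (\<lambda>t. f t *\<^sub>R g' t + f' t *\<^sub>R g t)"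
    using C_curve_Suc_imp[OF Suc.prems(1)] C_curve_Suc_imp[OF Suc.prems(2)] *
    by (intro C_curve_add Suc.IH)
  ultimately show ?case
    by (auto intro!: exI[of _ "\<lambda>t. f t *\<^sub>R g' t + f' t *\<^sub>R g t"])
qed

text \<open>
  Connects the existential description with iterated \<open>vector_derivative\<close>: on a
  nondegenerate interval one-sided derivatives are unique, so any chain of successive derivatives
  agrees with the iterated ones.
\<close>

lemma C_curve_nth_deriv_on:
  assumes "C_curve k {\<alpha>..\<beta>} g" "\<alpha> < \<beta>" "i < k" "t \<in> {\<alpha>..\<beta>}"
  shows "(nth_deriv_on {\<alpha>..\<beta>} i g has_real_derivative nth_deriv_on {\<alpha>..\<beta>} (Suc i) g t)
           (at t within {\<alpha>..\<beta>})"
proof -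
  have nbot: "at t within {\<alpha>..\<beta>} \<noteq> bot" if "t \<in> {\<alpha>..\<beta>}" for t
    using that \<open>\<alpha> < \<beta>\<close> by (simp add: trivial_limit_within)
  have "\<exists>d. d 0 = g \<and> (\<forall>i<k. \<forall>t\<in>{\<alpha>..\<beta>}. (d i has_vector_derivative d (Suc i) t) (at t within {\<alpha>..\<beta>}))"
    using assms(1)
  proof (induction k arbitrary: g)
    case 0
    show ?case by auto
  next
    case (Suc k)
    from Suc.prems obtain g' where
      g': "\<forall>t\<in>{\<alpha>..\<beta>}. (g has_vector_derivative g' t) (at t within {\<alpha>..\<beta>})"
        "C_curve k {\<alpha>..\<beta>} g'"
      by auto
    from Suc.IH[OF g'(2)] obtain d where "d 0 = g'"
      "\<forall>i<k. \<forall>t\<in>{\<alpha>..\<beta>}. (d i has_vector_derivative d (Suc i) t) (at t within {\<alpha>..\<beta>})"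
      by blast
    with g'(1) show ?case
      by (intro exI[of _ "case_nat g d"]) (auto split: nat.split simp: less_Suc_eq_0_disj)
  qed
  then obtain d where d0: "d 0 = g" and
    d: "\<And>i t. i < k \<Longrightarrow> t \<in> {\<alpha>..\<beta>} \<Longrightarrow> (d i has_vector_derivative d (Suc i) t) (at t within {\<alpha>..\<beta>})"
    by blast
  have step: "(nth_deriv_on {\<alpha>..\<beta>} i g has_vector_derivative d (Suc i) t) (at t within {\<alpha>..\<beta>})"
    if "\<forall>t\<in>{\<alpha>..\<beta>}. nth_deriv_on {\<alpha>..\<beta>} i g t = d i t" "i < k" "t \<in> {\<alpha>..\<beta>}" for i t
    using that d[OF that(2,3)] by (auto intro: has_vector_derivative_transform)
  have eq: "\<forall>t\<in>{\<alpha>..\<beta>}. nth_deriv_on {\<alpha>..\<beta>} i g t = d i t" if "i \<le> k" for i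
    using that
  proof (induction i)
    case (Suc i)
    then show ?case
      using step[of i] by (auto intro!: vector_derivative_within nbot)
  qed (simp add: d0)
  show ?thesis
    using step[OF eq, of i t] eq[of "Suc i"] assms(3,4)
    by (simp add: has_real_derivative_iff_has_vector_derivative del: nth_deriv_on.simps)
qed

section \<open>Smoothness of the right-hand side along the solution\<close>

text \<open>
  The mean value inequality along one coordinate segment, applied to
  \<open>g (p + t s e) - t s c\<close>. With \<open>c\<close> the partial derivative at a nearby base point, the
  right-hand side becomes small relative to \<open>\<bar>s\<bar>\<close>.
\<close>

lemma partial_increment_bound:
  fixes g :: "'a::real_normed_vector \<Rightarrow> 'b::real_normed_vector"
  assumes part: "\<And>q. q \<in> S \<Longrightarrow>
        ((\<lambda>t. g (q + t *\<^sub>R e)) has_vector_derivative D q) (at 0 within {t. q + t *\<^sub>R e \<in> S})"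
    and seg: "\<And>t. t \<in> {0..1} \<Longrightarrow> p + (t * s) *\<^sub>R e \<in> S"
    and bnd: "\<And>t. t \<in> {0..1} \<Longrightarrow> norm (D (p + (t * s) *\<^sub>R e) - c) \<le> B"
  shows "norm (g (p + s *\<^sub>R e) - g p - s *\<^sub>R c) \<le> B * \<bar>s\<bar>"
proof -
  define k where "k t = g (p + (t * s) *\<^sub>R e) - (t * s) *\<^sub>R c" for t
  have "((\<lambda>t. g (p + (t * s) *\<^sub>R e)) has_vector_derivative s *\<^sub>R D (p + (t * s) *\<^sub>R e)) (at t within {0..1})"
    if t: "t \<in> {0..1}" for t
  proof -
    let ?q = "p + (t * s) *\<^sub>R e"
    let ?r = "\<lambda>t'. (t' - t) * s"
    have r: "(?r has_vector_derivative s) (at t within {0..1})"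
      unfolding has_real_derivative_iff_has_vector_derivative[symmetric]
      by (auto intro!: derivative_eq_intros)
    have eq: "?q + ?r t' *\<^sub>R e = p + (t' * s) *\<^sub>R e" for t'
      by (simp add: algebra_simps)
    have "?r ` {0..1} \<subseteq> {r. ?q + r *\<^sub>R e \<in> S}"
      using seg by (auto simp: eq)
    then have "((\<lambda>r. g (?q + r *\<^sub>R e)) has_vector_derivative D ?q) (at (?r t) within ?r ` {0..1})"
      using part[OF seg[OF t]] by (auto intro: has_vector_derivative_within_subset)
    from vector_diff_chain_within[OF r this] show ?thesis
      unfolding comp_def eq .
  qed
  then have k': "(k has_vector_derivative s *\<^sub>R (D (p + (t * s) *\<^sub>R e) - c)) (at t within {0..1})"
    if "t \<in> {0..1}" for t
    unfolding k_def using that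
    by (auto intro!: derivative_eq_intros simp: scaleR_diff_right has_vector_derivative_def
        mult.commute mult.left_commute)
  have "norm (k 1 - k 0) \<le> (B * \<bar>s\<bar>) * norm (1 - 0 :: real)"
  proof (rule differentiable_bound[of "{0..1}"])
    fix t :: real assume t: "t \<in> {0..1}"
    show "(k has_derivative (\<lambda>r. r *\<^sub>R (s *\<^sub>R (D (p + (t * s) *\<^sub>R e) - c)))) (at t within {0..1})"
      using k'[OF t] by (simp add: has_vector_derivative_def)
    show "onorm (\<lambda>r. r *\<^sub>R (s *\<^sub>R (D (p + (t * s) *\<^sub>R e) - c))) \<le> B * \<bar>s\<bar>"
    proof (rule onorm_le)
      fix r :: real
      have "\<bar>r\<bar> * \<bar>s\<bar> * norm (D (p + (t * s) *\<^sub>R e) - c) \<le> \<bar>r\<bar> * \<bar>s\<bar> * B"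
        by (intro mult_left_mono bnd t) auto
      then show "norm (r *\<^sub>R (s *\<^sub>R (D (p + (t * s) *\<^sub>R e) - c))) \<le> B * \<bar>s\<bar> * norm r"
        by (simp add: abs_mult mult_ac)
    qed
  qed auto
  then show ?thesis by (simp add: k_def algebra_simps)
qed

text \<open>
  One walks from \<open>p\<close> to \<open>q\<close> by changing one coordinate after the other; on each
  coordinate segment continuity of the partial derivative makes the increment linear up to a small error. The first hypothesis
  makes \<open>S\<close> a product of intervals, which keeps all these coordinate segments inside \<open>S\<close>.
\<close>

lemma continuous_partials_imp_has_derivative:
  fixes g :: "'a::euclidean_space \<Rightarrow> 'b::real_normed_vector"
  assumes box: "\<And>q r. q \<in> S \<Longrightarrow> (\<And>e. e \<in> Basis \<Longrightarrow> \<exists>q'\<in>S. \<exists>\<theta>\<in>{0..1}. r \<bullet> e = (1 - \<theta>) * (q \<bullet> e) + \<theta> * (q' \<bullet> e)) \<Longrightarrow> r \<in> S"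
    and part: "\<And>e q. e \<in> Basis \<Longrightarrow> q \<in> S \<Longrightarrow>
        ((\<lambda>t. g (q + t *\<^sub>R e)) has_vector_derivative D e q) (at 0 within {t. q + t *\<^sub>R e \<in> S})"
    and cont: "\<And>e. e \<in> Basis \<Longrightarrow> continuous_on S (D e)"
    and p: "p \<in> S"
  shows "(g has_derivative (\<lambda>v. \<Sum>e\<in>Basis. (v \<bullet> e) *\<^sub>R D e p)) (at p within S)"
proof -
  define P where "P B v = (\<Sum>e\<in>B. (v \<bullet> e) *\<^sub>R e)" for B and v :: 'a
  have P_in: "p + P B (q - p) + (t * ((q - p) \<bullet> e)) *\<^sub>R e \<in> S"
    and P_norm: "norm (p + P B (q - p) + (t * ((q - p) \<bullet> e)) *\<^sub>R e - p) \<le> norm (q - p)"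
    if "q \<in> S" "finite B" "B \<subseteq> Basis" "e \<in> Basis" "e \<notin> B" "t \<in> {0..1}" for q B e t
  proof -
    have co: "(P B (q - p) + (t * ((q - p) \<bullet> e)) *\<^sub>R e) \<bullet> e' =
        (if e' \<in> B then 1 else if e' = e then t else 0) * ((q - p) \<bullet> e')" if "e' \<in> Basis" for e'
    proof -
      have "P B (q - p) \<bullet> e' = (\<Sum>i\<in>B. if i = e' then (q - p) \<bullet> e' else 0)"
        unfolding P_def inner_sum_left
        using that \<open>B \<subseteq> Basis\<close> by (intro sum.cong) (auto simp: inner_Basis)
      then show ?thesis
        using that \<open>finite B\<close> \<open>e \<in> Basis\<close> \<open>e \<notin> B\<close>
        by (auto simp: inner_left_distrib inner_Basis)
    qed
    show "p + P B (q - p) + (t * ((q - p) \<bullet> e)) *\<^sub>R e \<in> S"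
    proof (rule box[OF p])
      fix e' :: 'a assume e': "e' \<in> Basis"
      let ?\<theta> = "if e' \<in> B then 1 else if e' = e then t else 0"
      have "(p + P B (q - p) + (t * ((q - p) \<bullet> e)) *\<^sub>R e) \<bullet> e' = p \<bullet> e' + ?\<theta> * ((q - p) \<bullet> e')"
        using co[OF e'] by (simp only: add.assoc inner_add_left)
      also have "\<dots> = (1 - ?\<theta>) * (p \<bullet> e') + ?\<theta> * (q \<bullet> e')"
        by (simp add: inner_diff_left algebra_simps)
      finally show "\<exists>q'\<in>S. \<exists>\<theta>\<in>{0..1}. (p + P B (q - p) + (t * ((q - p) \<bullet> e)) *\<^sub>R e) \<bullet> e'
            = (1 - \<theta>) * (p \<bullet> e') + \<theta> * (q' \<bullet> e')"
        using \<open>q \<in> S\<close> \<open>t \<in> {0..1}\<close> by (intro bexI[of _ q] bexI[of _ ?\<theta>]) auto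
    qed
    have "norm (P B (q - p) + (t * ((q - p) \<bullet> e)) *\<^sub>R e) \<le> norm (q - p)"
    proof (rule norm_le_componentwise)
      fix e' :: 'a assume "e' \<in> Basis"
      then show "\<bar>(P B (q - p) + (t * ((q - p) \<bullet> e)) *\<^sub>R e) \<bullet> e'\<bar> \<le> \<bar>(q - p) \<bullet> e'\<bar>"
        using \<open>t \<in> {0..1}\<close> by (simp add: co abs_mult mult_left_le_one_le)
    qed
    then show "norm (p + P B (q - p) + (t * ((q - p) \<bullet> e)) *\<^sub>R e - p) \<le> norm (q - p)"
      by (simp add: add.assoc)
  qed
  \<comment> \<open>Induction on the set of coordinates that have already been changed.\<close>
  have main: "\<forall>\<epsilon>>0. \<exists>\<delta>>0. \<forall>q\<in>S. norm (q - p) < \<delta> \<longrightarrow>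
      norm (g (p + P B (q - p)) - g p - (\<Sum>e\<in>B. ((q - p) \<bullet> e) *\<^sub>R D e p)) \<le> \<epsilon> * norm (q - p)"
    if "finite B" "B \<subseteq> Basis" for B
    using that
  proof (induction B rule: finite_induct)
    case empty
    show ?case by (auto simp: P_def intro: exI[of _ 1])
  next
    case (insert e B)
    show ?case
    proof (intro allI impI)
      fix \<epsilon> :: real assume "\<epsilon> > 0"
      then obtain \<delta>1 where \<delta>1: "\<delta>1 > 0" "\<And>q. q \<in> S \<Longrightarrow> norm (q - p) < \<delta>1 \<Longrightarrow>
        norm (g (p + P B (q - p)) - g p - (\<Sum>e\<in>B. ((q - p) \<bullet> e) *\<^sub>R D e p)) \<le> \<epsilon> / 2 * norm (q - p)"
        using insert by (meson half_gt_zero insert_subset)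
      have e: "e \<in> Basis" using insert by auto
      obtain \<delta>2 where \<delta>2: "\<delta>2 > 0" "\<And>q. q \<in> S \<Longrightarrow> norm (q - p) < \<delta>2 \<Longrightarrow> norm (D e q - D e p) \<le> \<epsilon> / 2"
        using cont[OF e] p half_gt_zero[OF \<open>\<epsilon> > 0\<close>] unfolding continuous_on_iff dist_norm
        by (metis less_imp_le)
      show "\<exists>\<delta>>0. \<forall>q\<in>S. norm (q - p) < \<delta> \<longrightarrow>
        norm (g (p + P (insert e B) (q - p)) - g p - (\<Sum>e\<in>insert e B. ((q - p) \<bullet> e) *\<^sub>R D e p)) \<le> \<epsilon> * norm (q - p)"
      proof (intro exI[of _ "min \<delta>1 \<delta>2"] conjI ballI impI)
        fix q assume q: "q \<in> S" "norm (q - p) < min \<delta>1 \<delta>2"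
        let ?s = "(q - p) \<bullet> e" and ?p = "p + P B (q - p)"
        have "norm (g (?p + ?s *\<^sub>R e) - g ?p - ?s *\<^sub>R D e p) \<le> \<epsilon> / 2 * \<bar>?s\<bar>"
        proof (rule partial_increment_bound[of S g e "D e"])
          fix t :: real assume t: "t \<in> {0..1}"
          show "?p + (t * ?s) *\<^sub>R e \<in> S"
            using P_in[of q B e t] insert q t by auto
          then show "norm (D e (?p + (t * ?s) *\<^sub>R e) - D e p) \<le> \<epsilon> / 2"
            using P_norm[of q B e t] insert q t by (intro \<delta>2) auto
        qed (use part[OF e] in auto)
        also have "\<dots> \<le> \<epsilon> / 2 * norm (q - p)"
          using Basis_le_norm[OF e] \<open>\<epsilon> > 0\<close> by (intro mult_left_mono) auto
        finally have 1: "norm (g (?p + ?s *\<^sub>R e) - g ?p - ?s *\<^sub>R D e p) \<le> \<epsilon> / 2 * norm (q - p)" .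
        have 2: "norm (g ?p - g p - (\<Sum>e\<in>B. ((q - p) \<bullet> e) *\<^sub>R D e p)) \<le> \<epsilon> / 2 * norm (q - p)"
          using \<delta>1 q by auto
        have "g (p + P (insert e B) (q - p)) - g p - (\<Sum>e\<in>insert e B. ((q - p) \<bullet> e) *\<^sub>R D e p)
          = (g (?p + ?s *\<^sub>R e) - g ?p - ?s *\<^sub>R D e p) + (g ?p - g p - (\<Sum>e\<in>B. ((q - p) \<bullet> e) *\<^sub>R D e p))"
          using insert by (simp add: P_def add_ac)
        then show "norm (g (p + P (insert e B) (q - p)) - g p - (\<Sum>e\<in>insert e B. ((q - p) \<bullet> e) *\<^sub>R D e p)) \<le> \<epsilon> * norm (q - p)"
          using norm_triangle_mono[OF 1 2] by (simp only:)
      qed (use \<delta>1 \<delta>2 in auto)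
    qed
  qed
  have P_full: "p + P Basis (q - p) = q" for q
    by (simp add: P_def euclidean_representation)
  show ?thesis
    unfolding has_derivative_within_alt
  proof
    show "bounded_linear (\<lambda>v. \<Sum>e\<in>Basis. (v \<bullet> e) *\<^sub>R D e p)"
      by (intro bounded_linear_sum bounded_linear_intros)
    show "\<forall>\<epsilon>>0. \<exists>\<delta>>0. \<forall>q\<in>S. norm (q - p) < \<delta> \<longrightarrow>
      norm (g q - g p - (\<Sum>e\<in>Basis. ((q - p) \<bullet> e) *\<^sub>R D e p)) \<le> \<epsilon> * norm (q - p)"
      using main[of Basis] by (simp add: P_full)
  qed
qed

lemma C_partial_Suc_imp: "C_partial (Suc k) S g \<Longrightarrow> C_partial k S g"
proof (induction k arbitrary: g)
  case (Suc k)
  then show ?case by (metis C_partial.simps(2))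
qed auto

lemma C_partial_mono: "k \<le> l \<Longrightarrow> C_partial l S g \<Longrightarrow> C_partial k S g"
  by (induction rule: inc_induct) (auto intro: C_partial_Suc_imp simp del: C_partial.simps)

text \<open>
  The chain rule turns the derivative of \<open>x \<mapsto> g (x, y x)\<close> into a sum of partial
  derivatives of \<open>g\<close> along the curve, multiplied by components of \<open>(1, f x (y x))\<close>. Hence
  one order of smoothness of \<open>g\<close> is used up per derivative, while the second factor is \<open>f\<close>
  itself along the curve. The induction therefore has to run over all \<open>g\<close> simultaneously, so that its
  hypothesis applies both to the partial derivatives of \<open>g\<close> and to \<open>f\<close>.
\<close>

lemma C_partial_along_solution:
  fixes f :: "real \<Rightarrow> 'a::euclidean_space \<Rightarrow> 'a"
  assumes smooth: "C_partial m ({x0..xf} \<times> UNIV) (\<lambda>(x, z). f x z)"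
    and ode: "\<And>x. x \<in> {x0..xf} \<Longrightarrow> (y has_vector_derivative f x (y x)) (at x within {x0..xf})"
  shows "C_curve m {x0..xf} (\<lambda>x. f x (y x))"
proof -
  let ?S = "{x0..xf} \<times> (UNIV :: 'a set)" and ?c = "\<lambda>x. (x, y x)"
  have c': "(?c has_vector_derivative (1, f x (y x))) (at x within {x0..xf})" if "x \<in> {x0..xf}" for x
    using ode[OF that] by (intro has_vector_derivative_Pair) auto
  have y: "continuous_on {x0..xf} y"
    using ode by (meson continuous_on_eq_continuous_within has_vector_derivative_continuous)
  have box: "r \<in> ?S" if q: "q \<in> ?S" and
      r: "\<And>e. e \<in> Basis \<Longrightarrow> \<exists>q'\<in>?S. \<exists>\<theta>\<in>{0..1}. r \<bullet> e = (1 - \<theta>) * (q \<bullet> e) + \<theta> * (q' \<bullet> e)"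
    for q r :: "real \<times> 'a"
  proof -
    have "(1, 0) \<in> (Basis :: (real \<times> 'a) set)" by (simp add: Basis_prod_def)
    from r[OF this] obtain q' \<theta> where *: "q' \<in> ?S" "\<theta> \<in> {0..1}" "fst r = (1 - \<theta>) * fst q + \<theta> * fst q'"
      by (auto simp: inner_prod_def)
    have "(1 - \<theta>) *\<^sub>R fst q + \<theta> *\<^sub>R fst q' \<in> {x0..xf}"
      using * q by (intro convexD) auto
    with * show ?thesis by (simp add: mem_Times_iff)
  qed
  have "C_curve k {x0..xf} (\<lambda>x. g (?c x))" if "k \<le> m" "C_partial k ?S g" for k and g :: "real \<times> 'a \<Rightarrow> 'a"
    using that
  proof (induction k arbitrary: g)
    case 0
    have "continuous_on {x0..xf} (g \<circ> ?c)"
      using 0 y by (intro continuous_on_compose continuous_intros) (auto elim: continuous_on_subset)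
    then show ?case by (simp add: comp_def)
  next
    case (Suc k)
    from Suc.prems(2) obtain D where
      D: "\<And>e q. e \<in> Basis \<Longrightarrow> q \<in> ?S \<Longrightarrow>
        ((\<lambda>t. g (q + t *\<^sub>R e)) has_vector_derivative D e q) (at 0 within {t. q + t *\<^sub>R e \<in> ?S})"
      and Dk: "\<And>e. e \<in> Basis \<Longrightarrow> C_partial k ?S (D e)"
      unfolding C_partial.simps by blast
    have Dc: "continuous_on ?S (D e)" if "e \<in> Basis" for e
      using C_partial_mono[OF _ Dk[OF that], of 0] by simp
    let ?g' = "\<lambda>x. \<Sum>e\<in>Basis. ((1, f x (y x)) \<bullet> e) *\<^sub>R D e (?c x)"
    have deriv: "((\<lambda>x. g (?c x)) has_vector_derivative ?g' x) (at x within {x0..xf})"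
      if x: "x \<in> {x0..xf}" for x
    proof -
      have sub: "?c ` {x0..xf} \<subseteq> ?S" and cx: "?c x \<in> ?S" using x by auto
      have "(g has_derivative (\<lambda>v. \<Sum>e\<in>Basis. (v \<bullet> e) *\<^sub>R D e (?c x))) (at (?c x) within ?S)"
      proof (rule continuous_partials_imp_has_derivative)
        show "r \<in> ?S" if "q \<in> ?S"
          "\<And>e. e \<in> Basis \<Longrightarrow> \<exists>q'\<in>?S. \<exists>\<theta>\<in>{0..1}. r \<bullet> e = (1 - \<theta>) * (q \<bullet> e) + \<theta> * (q' \<bullet> e)" for q r
          using that by (rule box)
      qed (fact D Dc cx)+
      from diff_chain_within[OF c'[OF x, unfolded has_vector_derivative_def] has_derivative_subset[OF this sub]]
      have *: "((\<lambda>x. g (?c x)) has_derivative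
          (\<lambda>t. \<Sum>e\<in>Basis. ((t *\<^sub>R (1, f x (y x))) \<bullet> e) *\<^sub>R D e (?c x))) (at x within {x0..xf})"
        unfolding comp_def .
      show ?thesis
        unfolding has_vector_derivative_def using *
        by (simp only: inner_scaleR_left scaleR_sum_right scaleR_scaleR)
    qed
    have "C_partial k ?S (\<lambda>(x, z). f x z)"
      using C_partial_mono[OF _ smooth] Suc.prems by simp
    from Suc.IH[OF _ this] Suc.prems have "C_curve k {x0..xf} (\<lambda>x. f x (y x))" by simp
    then have "C_curve k {x0..xf} (\<lambda>x. (1, 0) + (0, f x (y x)))"
      by (intro C_curve_add C_curve_const C_curve_bounded_linear[where T = "\<lambda>v. (0, v)"]) 
         (auto intro!: bounded_linear_Pair bounded_linear_zero bounded_linear_ident)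
    then have "C_curve k {x0..xf} ?g'"
      using Suc.IH[OF _ Dk] Suc.prems
      by (intro C_curve_sum C_curve_scaleR C_curve_bounded_linear[OF bounded_linear_inner_left]) auto
    with deriv show ?case unfolding C_curve.simps by (intro exI[of _ ?g'] conjI ballI)
  qed
  from this[OF order_refl smooth] show ?thesis by simp
qed

section \<open>Lagrange interpolation and quadrature\<close>

text \<open>
  The zeros of \<open>g\<close> are added in increasing order. Remembering that the zeros of \<open>g'\<close> found
  so far do not exceed the largest zero of \<open>g\<close> so far makes the zero found by Rolle in the next
  gap a new one.
\<close>

lemma rolle_zeros_of_derivative:
  fixes g g' :: "real \<Rightarrow> real"
  assumes deriv: "\<And>t. t \<in> {\<alpha>..\<beta>} \<Longrightarrow> (g has_real_derivative g' t) (at t within {\<alpha>..\<beta>})"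
    and "finite Z" "Z \<subseteq> {\<alpha>..\<beta>}" "\<And>z. z \<in> Z \<Longrightarrow> g z = 0"
  shows "\<exists>Z'. finite Z' \<and> card Z \<le> Suc (card Z') \<and> Z' \<subseteq> {\<alpha>..\<beta>} \<and> (\<forall>z\<in>Z'. g' z = 0)"
proof -
  have "\<exists>Z'. finite Z' \<and> card Z \<le> Suc (card Z') \<and> Z' \<subseteq> {\<alpha>..\<beta>} \<and> (\<forall>z\<in>Z'. g' z = 0 \<and> (\<exists>u\<in>Z. z \<le> u))"
    using assms(2-4)
  proof (induction Z rule: finite_linorder_max_induct)
    case empty
    then show ?case by (intro exI[of _ "{}"]) auto
  next
    case (insert b A)
    then obtain Z' where Z': "finite Z'" "card A \<le> Suc (card Z')" "Z' \<subseteq> {\<alpha>..\<beta>}"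
      "\<forall>z\<in>Z'. g' z = 0 \<and> (\<exists>u\<in>A. z \<le> u)"
      by auto
    have cb: "card (insert b A) = Suc (card A)"
      using insert by (intro card_insert_disjoint) auto
    show ?case
    proof (cases "A = {}")
      case True
      then show ?thesis by (intro exI[of _ "{}"]) (auto simp: cb)
    next
      case False
      define c where "c = Max A"
      have c: "c \<in> A" "\<And>u. u \<in> A \<Longrightarrow> u \<le> c"
        using False insert(1) by (auto simp: c_def)
      then have cb': "\<alpha> \<le> c" "c < b" "b \<le> \<beta>" "g c = g b"
        using insert by auto
      have at: "(g has_real_derivative g' t) (at t)" if "c < t" "t < b" for t
        using deriv[of t] that cb' at_within_Icc_at[of \<alpha> t \<beta>] by auto
      have "continuous_on {\<alpha>..\<beta>} g"
        using deriv by (meson continuous_on_eq_continuous_within has_field_derivative_imp_has_derivative has_derivative_continuous)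
      then have "continuous_on {c..b} g"
        by (rule continuous_on_subset) (use cb' in auto)
      with Rolle[of c b g] cb' at obtain t where t: "c < t" "t < b" "DERIV g t :> 0"
        by (meson real_differentiable_def)
      then have "g' t = 0" using at DERIV_unique by blast
      moreover have "t \<notin> Z'" using Z'(4) c t by force
      ultimately show ?thesis
        using Z' t cb' cb by (intro exI[of _ "insert t Z'"]) (auto intro: less_imp_le)
    qed
  qed
  then show ?thesis by blast
qed

lemma iterated_rolle:
  fixes d :: "nat \<Rightarrow> real \<Rightarrow> real"
  assumes "\<And>i t. i < k \<Longrightarrow> t \<in> {\<alpha>..\<beta>} \<Longrightarrow>
        (d i has_real_derivative d (Suc i) t) (at t within {\<alpha>..\<beta>})"
    and "finite Z" "Z \<subseteq> {\<alpha>..\<beta>}" "k < card Z" "\<And>z. z \<in> Z \<Longrightarrow> d 0 z = 0"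
  shows "\<exists>t\<in>{\<alpha>..\<beta>}. d k t = 0"
  using assms
proof (induction k arbitrary: d Z)
  case 0
  then show ?case by (metis card_gt_0_iff equals0I subsetD)
next
  case (Suc k)
  obtain Z' where "finite Z'" "card Z \<le> Suc (card Z')" "Z' \<subseteq> {\<alpha>..\<beta>}" "\<forall>z\<in>Z'. d 1 z = 0"
    using rolle_zeros_of_derivative[of \<alpha> \<beta> "d 0" "d 1" Z] Suc.prems by auto
  then show ?case
    using Suc.IH[of "\<lambda>i. d (Suc i)" Z'] Suc.prems by auto
qed

lemma lagrange_fund_node:
  assumes "inj_on \<xi> {1..m}" "j \<in> {1..m}" "k \<in> {1..m}"
  shows "lagrange_fund \<xi> m j (\<xi> k) = (if j = k then 1 else 0)"
proof (cases "j = k")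
  case True
  have "\<xi> j \<noteq> \<xi> \<mu>" if "\<mu> \<in> {1..m} - {j}" for \<mu>
    using that assms by (auto dest: inj_onD)
  then show ?thesis using True by (auto simp: lagrange_fund_def intro!: prod.neutral)
next
  case False
  then show ?thesis using assms unfolding lagrange_fund_def
    by (auto intro!: prod_zero bexI[of _ k])
qed

lemma lagrange_fund_poly:
  assumes "j \<in> {1..m}"
  obtains q where "degree q < m" "poly q = lagrange_fund \<xi> m j"
proof -
  let ?q = "\<Prod>\<mu>\<in>{1..m} - {j}. [:- \<xi> \<mu> / (\<xi> j - \<xi> \<mu>), 1 / (\<xi> j - \<xi> \<mu>):]"
  have "degree ?q \<le> (\<Sum>\<mu>\<in>{1..m} - {j}. 1)"
    by (intro order.trans[OF degree_prod_sum_le] sum_mono) auto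
  also have "\<dots> < m" using assms by simp
  finally have "degree ?q < m" .
  moreover have "poly ?q = lagrange_fund \<xi> m j"
    by (auto simp: fun_eq_iff lagrange_fund_def poly_prod diff_divide_distrib intro!: prod.cong)
  ultimately show ?thesis using that by blast
qed

lemma continuous_on_lagrange_fund: "continuous_on S (lagrange_fund \<xi> m j)"
  unfolding lagrange_fund_def divide_inverse by (intro continuous_intros)

text \<open>
  Given \<open>t\<close> outside the nodes, subtract from the function \<open>d 0\<close> its interpolation polynomial
  \<open>p\<close> and that multiple \<open>c W\<close> of the node polynomial \<open>W\<close> for which the difference also
  vanishes at \<open>t\<close>. This difference has \<open>m + 1\<close> zeros, so by iterated Rolle its \<open>m\<close>-th
  derivative vanishes somewhere; as \<open>p\<close> has degree below \<open>m\<close> and \<open>W\<close> is monic of degree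
  \<open>m\<close>, this says \<open>d m \<eta> = c m!\<close>. The factor \<open>(\<beta> - \<alpha>) ^ m\<close> bounds \<open>\<bar>W t\<bar>\<close>.
\<close>

lemma lagrange_interpolation_error:
  fixes d :: "nat \<Rightarrow> real \<Rightarrow> real"
  assumes deriv: "\<And>i t. i < m \<Longrightarrow> t \<in> {\<alpha>..\<beta>} \<Longrightarrow>
        (d i has_real_derivative d (Suc i) t) (at t within {\<alpha>..\<beta>})"
    and bound: "\<And>t. t \<in> {\<alpha>..\<beta>} \<Longrightarrow> \<bar>d m t\<bar> \<le> C"
    and nodes: "inj_on \<xi> {1..m}" "\<xi> ` {1..m} \<subseteq> {\<alpha>..\<beta>}"
    and t: "t \<in> {\<alpha>..\<beta>}"
  shows "\<bar>d 0 t - (\<Sum>j=1..m. lagrange_fund \<xi> m j t * d 0 (\<xi> j))\<bar> \<le> C / fact m * (\<beta> - \<alpha>) ^ m"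
proof (cases "t \<in> \<xi> ` {1..m}")
  case True
  then obtain k where k: "k \<in> {1..m}" "t = \<xi> k" by auto
  have "(\<Sum>j=1..m. lagrange_fund \<xi> m j t * d 0 (\<xi> j)) = (\<Sum>j=1..m. if j = k then d 0 (\<xi> j) else 0)"
    using k nodes by (intro sum.cong) (simp_all add: lagrange_fund_node)
  also have "\<dots> = d 0 t" using k by simp
  finally have "d 0 t - (\<Sum>j=1..m. lagrange_fund \<xi> m j t * d 0 (\<xi> j)) = 0" by simp
  moreover have "C \<ge> 0" using bound[OF t] by linarith
  ultimately show ?thesis using t by (auto intro!: mult_nonneg_nonneg divide_nonneg_nonneg)
next
  case False
  have "\<forall>j\<in>{1..m}. \<exists>q. degree q < m \<and> poly q = lagrange_fund \<xi> m j"
    using lagrange_fund_poly by metis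
  then obtain q where q: "\<And>j. j \<in> {1..m} \<Longrightarrow> degree (q j) < m \<and> poly (q j) = lagrange_fund \<xi> m j"
    by metis
  define p where "p = (\<Sum>j=1..m. smult (d 0 (\<xi> j)) (q j))"
  define W where "W = (\<Prod>j=1..m. [:- \<xi> j, 1:])"
  have p: "poly p s = (\<Sum>j=1..m. lagrange_fund \<xi> m j s * d 0 (\<xi> j))" for s
    using q by (auto simp: p_def poly_sum mult.commute intro!: sum.cong)
  have W: "poly W s = (\<Prod>j=1..m. s - \<xi> j)" for s
    by (simp add: W_def poly_prod)
  have "W \<noteq> 0" by (simp add: W_def)
  then have Wdeg: "degree W = m" "coeff W m = 1"
    using lead_coeff_prod[of "\<lambda>j. [:- \<xi> j, 1:]" "{1..m}"] degree_prod_sum_eq[of "{1..m}" "\<lambda>j. [:- \<xi> j, 1:]"]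
    by (simp_all add: W_def)
  have Wt: "poly W t \<noteq> 0" using False by (auto simp: W)
  define c where "c = (d 0 t - poly p t) / poly W t"
  define Q where "Q = p + smult c W"
  have pm: "coeff p n = 0" if "n \<ge> m" for n
  proof -
    have "coeff (q j) n = 0" if "j \<in> {1..m}" for j
      using q[OF that] \<open>n \<ge> m\<close> by (intro coeff_eq_0) auto
    then show ?thesis by (simp add: p_def coeff_sum)
  qed
  have Qm: "(pderiv ^^ m) Q = [:c * fact m:]"
  proof (rule poly_eqI)
    fix n
    show "coeff ((pderiv ^^ m) Q) n = coeff [:c * fact m:] n"
      using pm[of "n + m"] Wdeg
      by (cases n) (auto simp: coeff_higher_pderiv Q_def pochhammer_fact coeff_eq_0 algebra_simps)
  qed
  define e where "e i s = d i s - poly ((pderiv ^^ i) Q) s" for i s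
  have "\<exists>\<eta>\<in>{\<alpha>..\<beta>}. e m \<eta> = 0"
  proof (rule iterated_rolle)
    fix i s assume "i < m" "s \<in> {\<alpha>..\<beta>}"
    then show "(e i has_real_derivative e (Suc i) s) (at s within {\<alpha>..\<beta>})"
      unfolding e_def using deriv[of i s]
      by (auto intro!: DERIV_diff has_field_derivative_at_within[OF poly_DERIV])
  next
    show "m < card (insert t (\<xi> ` {1..m}))"
      using False nodes by (simp add: card_image)
    fix z assume z: "z \<in> insert t (\<xi> ` {1..m})"
    show "e 0 z = 0"
    proof (cases "z = t")
      case True
      then show ?thesis using Wt by (simp add: e_def Q_def c_def)
    next
      case False
      with z obtain k where k: "k \<in> {1..m}" "z = \<xi> k" by auto
      have "poly p z = (\<Sum>j=1..m. if j = k then d 0 (\<xi> j) else 0)"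
        unfolding p using k nodes by (intro sum.cong) (simp_all add: lagrange_fund_node)
      moreover have "poly W z = 0" using k by (auto simp: W)
      ultimately show ?thesis using k by (simp add: e_def Q_def)
    qed
  qed (use nodes t in auto)
  then obtain \<eta> where \<eta>: "\<eta> \<in> {\<alpha>..\<beta>}" "d m \<eta> = c * fact m"
    by (auto simp: e_def Qm)
  have c: "\<bar>c\<bar> \<le> C / fact m"
    using bound[OF \<eta>(1)] \<eta>(2) by (simp add: abs_mult field_simps)
  have "\<bar>t - \<xi> j\<bar> \<le> \<beta> - \<alpha>" if "j \<in> {1..m}" for j
  proof -
    have "\<xi> j \<in> {\<alpha>..\<beta>}" using that nodes by blast
    then show ?thesis using t by auto
  qed
  then have "\<bar>poly W t\<bar> \<le> (\<Prod>j=1..m. \<beta> - \<alpha>)"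
    unfolding W abs_prod by (intro prod_mono) auto
  then have "\<bar>c\<bar> * \<bar>poly W t\<bar> \<le> C / fact m * (\<beta> - \<alpha>) ^ m"
    using c by (intro mult_mono) auto
  moreover have "d 0 t - poly p t = c * poly W t" using Wt by (simp add: c_def)
  ultimately show ?thesis by (simp add: p abs_mult)
qed

text \<open>
  Interpolation reproduces the constant function, by the error estimate with vanishing derivatives.
\<close>

lemma sum_lagrange_fund:
  assumes "inj_on \<xi> {1..m}" "m \<ge> 1"
  shows "(\<Sum>j=1..m. lagrange_fund \<xi> m j t) = 1"
proof -
  define \<alpha> where "\<alpha> = Min (insert t (\<xi> ` {1..m}))"
  define \<beta> where "\<beta> = Max (insert t (\<xi> ` {1..m}))"
  define d where "d i s = (if i = 0 then 1 else 0 :: real)" for i :: nat and s :: real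
  have "\<bar>d 0 t - (\<Sum>j=1..m. lagrange_fund \<xi> m j t * d 0 (\<xi> j))\<bar> \<le> 0 / fact m * (\<beta> - \<alpha>) ^ m"
  proof (rule lagrange_interpolation_error)
    show "\<xi> ` {1..m} \<subseteq> {\<alpha>..\<beta>}" "t \<in> {\<alpha>..\<beta>}"
      unfolding \<alpha>_def \<beta>_def atLeastAtMost_iff subset_iff
      by (intro allI impI conjI Min_le Max_ge; simp)+
  qed (use assms in \<open>auto simp: d_def\<close>)
  then show ?thesis by (simp add: d_def)
qed

lemma lagrange_quadrature_error:
  fixes d :: "nat \<Rightarrow> real \<Rightarrow> real"
  assumes deriv: "\<And>i t. i < m \<Longrightarrow> t \<in> {a..b} \<Longrightarrow>
        (d i has_real_derivative d (Suc i) t) (at t within {a..b})"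
    and bound: "\<And>t. t \<in> {a..b} \<Longrightarrow> \<bar>d m t\<bar> \<le> C"
    and nodes: "inj_on \<xi> {1..m}" "\<xi> ` {1..m} \<subseteq> {a..b}"
    and m: "m \<ge> 1" and s: "s \<in> {a..b}"
  shows "\<bar>integral {a..s} (d 0) - (\<Sum>j=1..m. integral {a..s} (lagrange_fund \<xi> m j) * d 0 (\<xi> j))\<bar>
           \<le> C / fact m * (b - a) ^ m * (b - a)"
proof -
  let ?B = "C / fact m * (b - a) ^ m"
  have err: "\<bar>d 0 t - (\<Sum>j=1..m. lagrange_fund \<xi> m j t * d 0 (\<xi> j))\<bar> \<le> ?B" if "t \<in> {a..b}" for t
    using lagrange_interpolation_error[OF deriv bound nodes that] by simp
  have "continuous_on {a..b} (d 0)"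
    using DERIV_continuous[OF deriv[of 0]] m
    by (auto simp: continuous_on_eq_continuous_within)
  then have d0: "d 0 integrable_on {a..s}"
    by (intro integrable_continuous_real) (use s in \<open>auto elim: continuous_on_subset\<close>)
  have l: "lagrange_fund \<xi> m j integrable_on {a..s}" for j
    by (intro integrable_continuous_real continuous_on_lagrange_fund)
  have "((\<lambda>t. d 0 t - (\<Sum>j=1..m. lagrange_fund \<xi> m j t * d 0 (\<xi> j))) has_integral
      (integral {a..s} (d 0) - (\<Sum>j=1..m. integral {a..s} (lagrange_fund \<xi> m j) * d 0 (\<xi> j)))) {a..s}"
    by (intro has_integral_diff has_integral_sum has_integral_mult_left integrable_integral d0 l) auto
  from has_integral_bound_real[OF order.trans[OF abs_ge_zero err[OF s]] finite.emptyI this]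
  have "\<bar>integral {a..s} (d 0) - (\<Sum>j=1..m. integral {a..s} (lagrange_fund \<xi> m j) * d 0 (\<xi> j))\<bar>
      \<le> ?B * measure lborel {a..s}"
    using err s by simp
  also have "\<dots> \<le> ?B * (b - a)"
    using s order.trans[OF abs_ge_zero err[OF s]] by (intro mult_left_mono) auto
  finally show ?thesis .
qed

section \<open>Discrete Gronwall inequality\<close>

lemma discrete_gronwall:
  fixes e :: "nat \<Rightarrow> real"
  assumes e0: "e 0 = 0" and step: "\<And>i. i < M \<Longrightarrow> e (Suc i) \<le> (1 + q) * e i + r"
    and q: "q > 0" and r: "r \<ge> 0" and i: "i \<le> M"
  shows "e i \<le> exp (real M * q) * (r / q)"
proof -
  have "e i \<le> ((1 + q) ^ i - 1) * (r / q)"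
    using i
  proof (induction i)
    case (Suc i)
    have "e (Suc i) \<le> (1 + q) * e i + r" using step Suc by simp
    also have "\<dots> \<le> (1 + q) * (((1 + q) ^ i - 1) * (r / q)) + r"
      using Suc q by (intro add_right_mono mult_left_mono) auto
    also have "\<dots> = ((1 + q) ^ Suc i - 1) * (r / q)"
      using q by (simp add: field_simps)
    finally show ?case .
  qed (simp add: e0)
  also have "\<dots> \<le> exp (real M * q) * (r / q)"
  proof (intro mult_right_mono)
    have "(1 + q) ^ i \<le> exp q ^ i"
      using q by (intro power_mono) auto
    also have "\<dots> = exp (real i * q)" by (simp add: exp_of_nat_mult)
    also have "\<dots> \<le> exp (real M * q)" using i q by simp
    finally show "(1 + q) ^ i - 1 \<le> exp (real M * q)" by simp
  qed (use q r in auto)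
  finally show ?thesis .
qed

section \<open>Error analysis of the Picard iteration\<close>

lemma infnorm_cart_le: "(\<And>i. \<bar>x $ i\<bar> \<le> c) \<Longrightarrow> infnorm (x :: real^'n) \<le> c"
  unfolding infnorm_cart by (rule cSup_least) auto

lemma infnorm_sum_le: "infnorm (\<Sum>j\<in>A. g j) \<le> (\<Sum>j\<in>A. infnorm (g j))"
proof (induction A rule: infinite_finite_induct)
  case (insert j A)
  then show ?case using infnorm_triangle[of "g j" "\<Sum>j\<in>A. g j"] by simp
qed (simp_all add: infnorm_0)

locale picard_ivp =
  fixes f :: "real \<Rightarrow> real^'N \<Rightarrow> real^'N"
    and y :: "real \<Rightarrow> real^'N"
    and x0 xf a b L Lt wt K Km :: real
    and \<xi> :: "nat \<Rightarrow> real" and m :: nat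
  assumes interval: "x0 < xf"
    and L_pos: "L > 0"
    and f_lipschitz: "\<And>x z1 z2 \<mu>. x \<in> {x0..xf} \<Longrightarrow>
          \<bar>f x z1 $ \<mu> - f x z2 $ \<mu>\<bar> \<le> L * (\<Sum>j\<in>UNIV. \<bar>z1 $ j - z2 $ j\<bar>)"
    and f_smooth: "C_partial m ({x0..xf} \<times> UNIV) (\<lambda>(x, z). f x z)"
    and y_ode: "\<And>x. x \<in> {x0..xf} \<Longrightarrow>
          (y has_vector_derivative f x (y x)) (at x within {x0..xf})"
    and m_pos: "m \<ge> 1"
    and ref_interval: "a < b"
    and nodes_inj: "inj_on \<xi> {1..m}"
    and nodes_in: "\<xi> ` {1..m} \<subseteq> {a..b}"
    and K_pos: "K > 0"
    and K_bound: "\<And>\<mu> x. x \<in> {x0..xf} \<Longrightarrow> \<bar>f x (y x) $ \<mu>\<bar> \<le> K"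
    and Km_pos: "Km > 0"
    and Km_bound: "\<And>\<mu> x. x \<in> {x0..xf} \<Longrightarrow>
          \<bar>nth_deriv_on {x0..xf} m (\<lambda>s. f s (y s) $ \<mu>) x\<bar> \<le> Km"
    and Lt_eq: "Lt = real CARD('N) * L"
    and wt_eq: "wt = real m * max_weight a b \<xi> m"
begin

lemma node_mem: "j \<in> {1..m} \<Longrightarrow> \<xi> j \<in> {a..b}"
  using nodes_in by blast

lemma Lt_pos: "Lt > 0"
  using L_pos by (simp add: Lt_eq)

lemma f_lipschitz_infnorm:
  assumes "x \<in> {x0..xf}"
  shows "infnorm (f x z1 - f x z2) \<le> Lt * infnorm (z1 - z2)"
proof (rule infnorm_cart_le)
  fix \<mu>
  have "\<bar>(f x z1 - f x z2) $ \<mu>\<bar> \<le> L * (\<Sum>j\<in>UNIV. \<bar>(z1 - z2) $ j\<bar>)"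
    using f_lipschitz[OF assms] by simp
  also have "\<dots> \<le> L * (\<Sum>j\<in>(UNIV::'N set). infnorm (z1 - z2))"
    using L_pos by (intro mult_left_mono sum_mono component_le_infnorm_cart) auto
  finally show "\<bar>(f x z1 - f x z2) $ \<mu>\<bar> \<le> Lt * infnorm (z1 - z2)"
    by (simp add: Lt_eq mult_ac)
qed

lemma node_weight_le: "j \<in> {1..m} \<Longrightarrow> k \<in> {1..m} \<Longrightarrow> \<bar>node_weight a b \<xi> m j k\<bar> \<le> max_weight a b \<xi> m"
  unfolding max_weight_def by (rule max.coboundedI1, rule Max_ge) auto

lemma full_weight_le:
  "j \<in> {1..m} \<Longrightarrow> \<bar>1 / (b - a) * integral {a..b} (lagrange_fund \<xi> m j)\<bar> \<le> max_weight a b \<xi> m"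
  unfolding max_weight_def using ref_interval
  by (intro max.coboundedI2 Max_ge) (auto simp: abs_mult)

text \<open>
  The full-interval weights sum to \<open>1\<close>, since the Lagrange polynomials do, so the largest of the \<open>m\<close> weights is
  at least \<open>1 / m\<close>. In particular the denominators of the error bound are positive.
\<close>

lemma wt_ge_1: "wt \<ge> 1"
proof -
  have "((\<lambda>t. \<Sum>j=1..m. lagrange_fund \<xi> m j t) has_integral
      (\<Sum>j=1..m. integral {a..b} (lagrange_fund \<xi> m j))) {a..b}"
    by (intro has_integral_sum integrable_integral integrable_continuous_real continuous_on_lagrange_fund) auto
  then have "((\<lambda>t. 1) has_integral (\<Sum>j=1..m. integral {a..b} (lagrange_fund \<xi> m j))) {a..b}"
    using sum_lagrange_fund[OF nodes_inj m_pos] by simp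
  from has_integral_unique[OF this has_integral_const_real]
  have "(\<Sum>j=1..m. integral {a..b} (lagrange_fund \<xi> m j)) = b - a"
    using ref_interval by simp
  then have "1 = (\<Sum>j=1..m. 1 / (b - a) * integral {a..b} (lagrange_fund \<xi> m j))"
    using ref_interval by (simp flip: sum_divide_distrib)
  also have "\<dots> \<le> (\<Sum>j=1..m. max_weight a b \<xi> m)"
    by (intro sum_mono order.trans[OF abs_ge_self full_weight_le])
  finally show ?thesis by (simp add: wt_eq)
qed

lemma ref_map_bounds:
  assumes "h > 0" "s \<in> {a..b}"
  shows "ref_map a b h x s \<in> {x..x + h}"
proof -
  have "h / (b - a) * (s - a) \<le> h / (b - a) * (b - a)"
    using assms ref_interval by (intro mult_left_mono) auto
  then show ?thesis using assms ref_interval by (auto simp: ref_map_def)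
qed

lemma y_component:
  assumes "x \<in> {x0..xf}"
  shows "((\<lambda>x. y x $ \<mu>) has_real_derivative f x (y x) $ \<mu>) (at x within {x0..xf})"
  using bounded_linear.has_vector_derivative[OF bounded_linear_vec_nth y_ode[OF assms]]
  by (simp add: has_real_derivative_iff_has_vector_derivative)

lemma solution_increment:
  assumes "x0 \<le> x" "x \<le> x'" "x' \<le> xf"
  shows "infnorm (y x' - y x) \<le> (x' - x) * K"
proof (rule infnorm_cart_le)
  fix \<mu>
  have "norm (y x' $ \<mu> - y x $ \<mu>) \<le> K * norm (x' - x)"
    by (rule field_differentiable_bound[of "{x..x'}" _ "\<lambda>x. f x (y x) $ \<mu>"])
      (use assms K_bound in \<open>auto intro: DERIV_subset[OF y_component]\<close>)
  then show "\<bar>(y x' - y x) $ \<mu>\<bar> \<le> (x' - x) * K" using assms by (simp add: mult.commute)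
qed

text \<open>
  How well the exact solution satisfies the discretised integral equation: after the substitution
  \<open>x = \<phi> t\<close> this is the quadrature error of \<open>t \<mapsto> f (\<phi> t) (y (\<phi> t))\<close> on
  \<open>[a, s]\<close>, multiplied by \<open>c = h / (b - a)\<close>. The \<open>m\<close>-th derivative of that function
  carries a factor \<open>c ^ m\<close>, which combines with \<open>(b - a) ^ m\<close> to \<open>h ^ m\<close>.
\<close>

lemma collocation_defect:
  assumes h: "h > 0" and x: "x0 \<le> x" "x + h \<le> xf" and s: "s \<in> {a..b}"
  defines "\<phi> \<equiv> ref_map a b h x"
  shows "infnorm (y (\<phi> s) - y x - h *\<^sub>R (\<Sum>j=1..m. (1 / (b - a) * integral {a..s} (lagrange_fund \<xi> m j)) *\<^sub>R
            f (\<phi> (\<xi> j)) (y (\<phi> (\<xi> j))))) \<le> h * (Km * h ^ m / fact m)"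
proof (rule infnorm_cart_le)
  fix \<mu>
  let ?F = "\<lambda>x. f x (y x) $ \<mu>"
  define c where "c = h / (b - a)"
  have c: "c > 0" using h ref_interval by (simp add: c_def)
  have \<phi>_in: "\<phi> t \<in> {x0..xf}" if "t \<in> {a..b}" for t
    using ref_map_bounds[OF h that, of x] x by (auto simp: \<phi>_def)
  have \<phi>': "(\<phi> has_real_derivative c) (at t within {a..b})" for t
    unfolding \<phi>_def ref_map_def c_def using ref_interval by (auto intro!: derivative_eq_intros)
  have chain: "((\<lambda>t. G (\<phi> t)) has_real_derivative c * D) (at t within {a..b})"
    if "t \<in> {a..b}" "(G has_real_derivative D) (at (\<phi> t) within {x0..xf})" for G D t
  proof -
    have "(G has_real_derivative D) (at (\<phi> t) within \<phi> ` {a..b})"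
      using that(2) by (rule DERIV_subset) (use \<phi>_in in auto)
    from DERIV_image_chain[OF this \<phi>'] show ?thesis by (simp add: comp_def mult.commute)
  qed
  have smooth: "C_curve m {x0..xf} ?F"
    by (rule C_curve_bounded_linear[OF bounded_linear_vec_nth C_partial_along_solution[OF f_smooth y_ode]])
  define d where "d i t = c ^ i * nth_deriv_on {x0..xf} i ?F (\<phi> t)" for i t
  have quad: "\<bar>integral {a..s} (d 0) - (\<Sum>j=1..m. integral {a..s} (lagrange_fund \<xi> m j) * d 0 (\<xi> j))\<bar>
           \<le> (c ^ m * Km) / fact m * (b - a) ^ m * (b - a)"
  proof (rule lagrange_quadrature_error[OF _ _ nodes_inj nodes_in m_pos s])
    fix i t assume "i < m" "t \<in> {a..b}"
    then show "(d i has_real_derivative d (Suc i) t) (at t within {a..b})"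
      using DERIV_cmult[OF chain[OF _ C_curve_nth_deriv_on[OF smooth interval]], of t i "c ^ i"] \<phi>_in
      unfolding d_def by (simp add: mult_ac del: nth_deriv_on.simps)
  next
    fix t assume "t \<in> {a..b}"
    then show "\<bar>d m t\<bar> \<le> c ^ m * Km"
      using Km_bound[OF \<phi>_in] c by (auto simp: d_def abs_mult)
  qed
  have "(d 0 has_integral (y (\<phi> s) $ \<mu> / c - y (\<phi> a) $ \<mu> / c)) {a..s}"
  proof (rule fundamental_theorem_of_calculus)
    fix t assume t: "t \<in> {a..s}"
    then have t': "t \<in> {a..b}" using s by auto
    have "((\<lambda>t. y (\<phi> t) $ \<mu> / c) has_real_derivative c * ?F (\<phi> t) / c) (at t within {a..b})"
      by (intro DERIV_cdivide chain y_component t' \<phi>_in)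
    then show "((\<lambda>t. y (\<phi> t) $ \<mu> / c) has_vector_derivative d 0 t) (at t within {a..s})"
      unfolding has_real_derivative_iff_has_vector_derivative[symmetric]
      using c s by (auto simp: d_def intro: DERIV_subset)
  qed (use s in auto)
  then have ftc: "integral {a..s} (d 0) = (y (\<phi> s) $ \<mu> - y x $ \<mu>) / c"
    by (simp add: integral_unique \<phi>_def ref_map_def diff_divide_distrib)
  have "(y (\<phi> s) - y x - h *\<^sub>R (\<Sum>j=1..m. (1 / (b - a) * integral {a..s} (lagrange_fund \<xi> m j)) *\<^sub>R
            f (\<phi> (\<xi> j)) (y (\<phi> (\<xi> j))))) $ \<mu>
     = c * (integral {a..s} (d 0) - (\<Sum>j=1..m. integral {a..s} (lagrange_fund \<xi> m j) * d 0 (\<xi> j)))"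
    unfolding right_diff_distrib ftc using h ref_interval
    by (simp add: d_def c_def sum_distrib_left sum_component)
  also have "\<bar>\<dots>\<bar> \<le> c * ((c ^ m * Km) / fact m * (b - a) ^ m * (b - a))"
    unfolding abs_mult using quad c by (intro mult_mono) auto
  also have "\<dots> = (c * (b - a)) * (Km * (c * (b - a)) ^ m / fact m)"
    by (simp add: power_mult_distrib mult_ac)
  also have "\<dots> = h * (Km * h ^ m / fact m)"
    using ref_interval by (simp add: c_def)
  finally show "\<bar>(y (\<phi> s) - y x - h *\<^sub>R (\<Sum>j=1..m. (1 / (b - a) * integral {a..s} (lagrange_fund \<xi> m j)) *\<^sub>R
            f (\<phi> (\<xi> j)) (y (\<phi> (\<xi> j))))) $ \<mu>\<bar> \<le> h * (Km * h ^ m / fact m)" .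
qed

text \<open>
  One application of the discrete Picard operator, at an arbitrary reference point \<open>s\<close>. The choice
  \<open>s = \<xi> k\<close> gives an inner iteration, the choice \<open>s = b\<close> the final update of the
  full-step variant.
\<close>

lemma stage_error:
  assumes h: "h > 0" and x: "x0 \<le> x" "x + h \<le> xf" and s: "s \<in> {a..b}"
    and c: "\<And>j. j \<in> {1..m} \<Longrightarrow> c j = 1 / (b - a) * integral {a..s} (lagrange_fund \<xi> m j)"
    and c_le: "\<And>j. j \<in> {1..m} \<Longrightarrow> \<bar>c j\<bar> \<le> max_weight a b \<xi> m"
    and E: "\<And>j. j \<in> {1..m} \<Longrightarrow> infnorm (y (ref_map a b h x (\<xi> j)) - U j) \<le> E"
  shows "infnorm (y (ref_map a b h x s) - (u + h *\<^sub>R (\<Sum>j=1..m. c j *\<^sub>R f (ref_map a b h x (\<xi> j)) (U j))))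
          \<le> infnorm (y x - u) + h * (Km * h ^ m / fact m) + h * Lt * wt * E"
proof -
  let ?\<phi> = "ref_map a b h x"
  let ?df = "\<lambda>j. f (?\<phi> (\<xi> j)) (y (?\<phi> (\<xi> j))) - f (?\<phi> (\<xi> j)) (U j)"
  let ?R = "y (?\<phi> s) - y x - h *\<^sub>R (\<Sum>j=1..m. c j *\<^sub>R f (?\<phi> (\<xi> j)) (y (?\<phi> (\<xi> j))))"
  have R: "infnorm ?R \<le> h * (Km * h ^ m / fact m)"
    using collocation_defect[OF h x s] c by simp
  have "infnorm (\<Sum>j=1..m. c j *\<^sub>R ?df j) \<le> (\<Sum>j=1..m. infnorm (c j *\<^sub>R ?df j))"
    by (rule infnorm_sum_le)
  also have "\<dots> \<le> (\<Sum>j=1..m. max_weight a b \<xi> m * (Lt * E))"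
  proof (rule sum_mono)
    fix j assume j: "j \<in> {1..m}"
    then have "\<xi> j \<in> {a..b}" by (rule node_mem)
    then have "?\<phi> (\<xi> j) \<in> {x0..xf}" using ref_map_bounds[OF h, of "\<xi> j" x] x by auto
    then have "infnorm (?df j) \<le> Lt * E"
      using order.trans[OF f_lipschitz_infnorm mult_left_mono[OF E[OF j]]] Lt_pos by simp
    then show "infnorm (c j *\<^sub>R ?df j) \<le> max_weight a b \<xi> m * (Lt * E)"
      unfolding infnorm_mul using c_le[OF j] by (intro mult_mono) (auto simp: infnorm_pos_le)
  qed
  finally have "infnorm (h *\<^sub>R (\<Sum>j=1..m. c j *\<^sub>R ?df j)) \<le> h * Lt * wt * E"
    unfolding infnorm_mul using h by (simp add: wt_eq mult_ac)
  moreover have "y (?\<phi> s) - (u + h *\<^sub>R (\<Sum>j=1..m. c j *\<^sub>R f (?\<phi> (\<xi> j)) (U j)))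
      = (y x - u) + ?R + h *\<^sub>R (\<Sum>j=1..m. c j *\<^sub>R ?df j)"
    by (simp add: scaleR_diff_right sum_subtractf)
  ultimately show ?thesis
    using R infnorm_triangle[of "y x - u" ?R]
      infnorm_triangle[of "(y x - u) + ?R" "h *\<^sub>R (\<Sum>j=1..m. c j *\<^sub>R ?df j)"]
    by (smt (verit))
qed

text \<open>
  The recursion \<open>E \<mapsto> A + \<theta> E\<close> from \<open>stage_error\<close>, with \<open>\<theta> = h Lt wt\<close>, has the fixed point
  \<open>A / (1 - \<theta>)\<close>, and deviations from it shrink by the factor \<open>\<theta>\<close>. The constant
  initial guess exceeds the fixed point by at most \<open>h K\<close>, because the solution moves by at most that
  amount within a step.
\<close>

lemma picard_iter_error:
  assumes h: "h > 0" and x: "x0 \<le> x" "x + h \<le> xf" and contr: "h * Lt * wt < 1"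
    and k: "k \<in> {1..m}"
  shows "infnorm (y (ref_map a b h x (\<xi> k)) - picard_iter f a b \<xi> m h x u n k)
     \<le> (infnorm (y x - u) + h * (Km * h ^ m / fact m)) / (1 - h * Lt * wt) + (h * Lt * wt) ^ n * (h * K)"
  using k
proof (induction n arbitrary: k)
  case 0
  have s: "\<xi> k \<in> {a..b}" using 0 by (rule node_mem)
  have \<theta>: "h * Lt * wt > 0" using h Lt_pos wt_ge_1 by (simp add: mult_pos_pos)
  let ?e = "infnorm (y x - u)"
  have "infnorm (y (ref_map a b h x (\<xi> k)) - y x) \<le> (ref_map a b h x (\<xi> k) - x) * K"
    by (rule solution_increment) (use ref_map_bounds[OF h s, of x] x in auto)
  also have "\<dots> \<le> h * K"
    using ref_map_bounds[OF h s, of x] K_pos by (intro mult_right_mono) auto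
  finally have "infnorm (y (ref_map a b h x (\<xi> k)) - u) \<le> ?e + h * K"
    using infnorm_triangle[of "y (ref_map a b h x (\<xi> k)) - y x" "y x - u"] by simp
  moreover have "?e \<le> (?e + h * (Km * h ^ m / fact m)) / (1 - h * Lt * wt)"
  proof -
    have "?e * (1 - h * Lt * wt) \<le> ?e * 1"
      using \<theta> by (intro mult_left_mono) (auto simp: infnorm_pos_le)
    also have "\<dots> \<le> ?e + h * (Km * h ^ m / fact m)" using h Km_pos by simp
    finally show ?thesis using contr by (simp add: pos_le_divide_eq)
  qed
  ultimately show ?case by simp
next
  case (Suc n)
  let ?A = "infnorm (y x - u) + h * (Km * h ^ m / fact m)" and ?\<theta> = "h * Lt * wt"
  have s: "\<xi> k \<in> {a..b}" using Suc.prems by (rule node_mem)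
  have "infnorm (y (ref_map a b h x (\<xi> k)) - picard_iter f a b \<xi> m h x u (Suc n) k)
      \<le> ?A + ?\<theta> * (?A / (1 - ?\<theta>) + ?\<theta> ^ n * (h * K))"
    unfolding picard_iter.simps
    by (rule stage_error[OF h x s _ _ Suc.IH]) (use Suc.prems node_weight_le in \<open>auto simp: node_weight_def\<close>)
  also have "\<dots> = ?A / (1 - ?\<theta>) + ?\<theta> ^ Suc n * (h * K)"
    using contr by (simp add: field_simps)
  finally show ?case .
qed

text \<open>
  Both variants obey the bound \<open>(e + h r) / (1 - \<theta>) + \<theta> h K\<close>: the last node directly
  because \<open>\<theta> ^ n \<le> \<theta>\<close> for \<open>n \<ge> 1\<close>, the full step because one more application of
  \<open>stage_error\<close> preserves it. The amplification factor
  \<open>1 / (1 - \<theta>) = 1 + \<theta> / (1 - \<theta>)\<close> is then enlarged by \<open>\<theta>\<close> to match the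
  exponent of the global estimate.
\<close>

lemma picard_step_error:
  assumes h: "h > 0" and x: "x0 \<le> x" "x + h \<le> xf" and contr: "h * Lt * wt < 1" and n: "n \<ge> 1"
  shows "node_error y (picard_step v f a b \<xi> m h n (x, u))
     \<le> (1 + h * (Lt * wt + Lt * wt / (1 - h * Lt * wt))) * infnorm (y x - u)
        + h * (h * Lt * wt * K + Km * h ^ m / (fact m * (1 - h * Lt * wt)))"
proof -
  define \<theta> where "\<theta> = h * Lt * wt"
  define e where "e = infnorm (y x - u)"
  define r where "r = Km * h ^ m / fact m"
  have \<theta>: "0 < \<theta>" "\<theta> < 1" using h Lt_pos wt_ge_1 contr by (simp_all add: \<theta>_def mult_pos_pos)
  have e: "e \<ge> 0" by (simp add: e_def infnorm_pos_le)
  have iter: "infnorm (y (ref_map a b h x (\<xi> k)) - picard_iter f a b \<xi> m h x u n k)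
      \<le> (e + h * r) / (1 - \<theta>) + \<theta> * (h * K)" if "k \<in> {1..m}" for k
  proof -
    have "\<theta> ^ n \<le> \<theta> ^ 1" using \<theta> n by (intro power_decreasing) auto
    then have "\<theta> ^ n * (h * K) \<le> \<theta> * (h * K)" using h K_pos by (intro mult_right_mono) auto
    then show ?thesis
      using picard_iter_error[OF h x contr that, of u n] unfolding \<theta>_def e_def r_def by linarith
  qed
  have "node_error y (picard_step v f a b \<xi> m h n (x, u)) \<le> (e + h * r) / (1 - \<theta>) + \<theta> * (h * K)"
  proof (cases v)
    case Last_Node
    then show ?thesis using iter[of m] m_pos by (simp add: node_error_def)
  next
    case Full_Step
    have "node_error y (picard_step v f a b \<xi> m h n (x, u)) =
      infnorm (y (ref_map a b h x b) - (u + h *\<^sub>R (\<Sum>j=1..m. (1 / (b - a) * integral {a..b} (lagrange_fund \<xi> m j)) *\<^sub>R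
            f (ref_map a b h x (\<xi> j)) (picard_iter f a b \<xi> m h x u n j))))"
      by (simp add: Full_Step node_error_def scaleR_sum_right)
    also have "\<dots> \<le> e + h * r + \<theta> * ((e + h * r) / (1 - \<theta>) + \<theta> * (h * K))"
      unfolding \<theta>_def e_def r_def
      by (rule stage_error[OF h x]) (use ref_interval full_weight_le iter in \<open>auto simp: \<theta>_def e_def r_def\<close>)
    also have "\<dots> = (e + h * r) / (1 - \<theta>) + \<theta> * (\<theta> * (h * K))"
    proof -
      have "A + \<theta> * (A / (1 - \<theta>)) = A / (1 - \<theta>)" for A
        using \<theta> by (simp add: field_simps)
      from this[of "e + h * r"] show ?thesis by (simp only: distrib_left flip: add.assoc)
    qed
    also have "\<dots> \<le> (e + h * r) / (1 - \<theta>) + \<theta> * (h * K)"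
      using \<theta> h K_pos by (intro add_left_mono mult_left_mono mult_left_le_one_le) auto
    finally show ?thesis .
  qed
  also have "\<dots> = (1 + \<theta> / (1 - \<theta>)) * e + h * (\<theta> * K + r / (1 - \<theta>))"
  proof -
    have 1: "1 + \<theta> / (1 - \<theta>) = 1 / (1 - \<theta>)" using \<theta> by (simp add: field_simps)
    show ?thesis unfolding 1 by (simp add: add_divide_distrib algebra_simps)
  qed
  also have "\<dots> \<le> (1 + (\<theta> + \<theta> / (1 - \<theta>))) * e + h * (\<theta> * K + r / (1 - \<theta>))"
    using \<theta> e by (intro add_right_mono mult_right_mono) auto
  finally show ?thesis
    by (simp add: \<theta>_def e_def r_def distrib_left mult.assoc)
qed

lemma picard_step_mesh:
  assumes "h > 0"
  shows "fst (picard_step v f a b \<xi> m h n (x, u)) \<in> {x..x + h}"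
proof -
  have "\<xi> m \<in> {a..b}" using node_mem m_pos by simp
  then show ?thesis
    using ref_map_bounds[OF assms, of "\<xi> m" x] ref_map_bounds[OF assms, of b x] ref_interval
    by (cases v) auto
qed

text \<open>
  For the last-node variant the mesh may end before \<open>xf\<close>; it suffices that it never leaves the
  interval on which the solution is known.
\<close>

lemma picard_mesh:
  assumes "h > 0"
  shows "fst (picard_method v f a b \<xi> m h n x0 (y x0) i) \<in> {x0..x0 + real i * h}"
proof (induction i)
  case (Suc i)
  then show ?case
    using picard_step_mesh[OF assms, of v "n i" "fst (picard_method v f a b \<xi> m h n x0 (y x0) i)"
        "snd (picard_method v f a b \<xi> m h n x0 (y x0) i)"]
    by (auto simp: algebra_simps)
qed auto

lemma picard_method_error:
  assumes M: "M \<ge> 1" and n: "\<And>i. i < M \<Longrightarrow> n i \<ge> 1" and h: "h = (xf - x0) / real M"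
    and contr: "h * Lt * wt < 1"
  shows "(MAX i\<in>{1..M}. node_error y (picard_method v f a b \<xi> m h n x0 (y x0) i))
              \<le> exp ((xf - x0) * Lt * wt * (1 + 1 / (1 - h * Lt * wt)))
                 * ((h * Lt * wt * K + Km * h ^ m / (fact m * (1 - h * Lt * wt)))
                    / (Lt * wt + Lt * wt / (1 - h * Lt * wt)))"
proof -
  define C where "C = Lt * wt + Lt * wt / (1 - h * Lt * wt)"
  define r where "r = h * Lt * wt * K + Km * h ^ m / (fact m * (1 - h * Lt * wt))"
  have h0: "h > 0" and Mh: "real M * h = xf - x0"
    using M interval h by simp_all
  have C: "C > 0" unfolding C_def
    using Lt_pos wt_ge_1 contr by (intro add_pos_pos mult_pos_pos divide_pos_pos) auto
  have r: "r \<ge> 0" unfolding r_def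
    using Lt_pos wt_ge_1 contr h0 K_pos Km_pos
    by (intro add_nonneg_nonneg mult_nonneg_nonneg divide_nonneg_nonneg) auto
  let ?s = "picard_method v f a b \<xi> m h n x0 (y x0)"
  have step: "node_error y (?s (Suc i)) \<le> (1 + h * C) * node_error y (?s i) + h * r" if i: "i < M" for i
  proof -
    have "real i * h + h = real (Suc i) * h" by (simp add: algebra_simps)
    also have "\<dots> \<le> real M * h" using i h0 by (intro mult_right_mono) auto
    finally have "fst (?s i) + h \<le> xf" "x0 \<le> fst (?s i)"
      using picard_mesh[OF h0, of v n i] Mh by auto
    from picard_step_error[OF h0 this(2,1) contr n[OF i], of v "snd (?s i)"]
    show ?thesis by (simp add: C_def r_def node_error_def)
  qed
  have "node_error y (?s i) \<le> exp (real M * (h * C)) * (h * r / (h * C))" if "i \<le> M" for i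
    by (rule discrete_gronwall[where e = "\<lambda>i. node_error y (?s i)", OF _ step])
      (use h0 C r that in \<open>auto simp: node_error_def infnorm_0\<close>)
  moreover have "real M * (h * C) = (xf - x0) * Lt * wt * (1 + 1 / (1 - h * Lt * wt))"
    unfolding C_def Mh[symmetric] by (simp add: algebra_simps)
  moreover have "h * r / (h * C) = r / C" using h0 by simp
  ultimately show ?thesis using M by (auto simp: C_def r_def)
qed

lemma picard_method_converges:
  assumes n: "\<And>M i. M \<ge> 1 \<Longrightarrow> i < M \<Longrightarrow> n M i \<ge> (1::nat)"
  shows "(\<lambda>M. MAX i\<in>{1..M}. node_error y
            (picard_method v f a b \<xi> m ((xf - x0) / real M) (n M) x0 (y x0) i)) \<longlonglongrightarrow> 0"
proof -
  define B where "B h = exp ((xf - x0) * Lt * wt * (1 + 1 / (1 - h * Lt * wt)))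
                 * ((h * Lt * wt * K + Km * h ^ m / (fact m * (1 - h * Lt * wt)))
                    / (Lt * wt + Lt * wt / (1 - h * Lt * wt)))" for h
  have h: "(\<lambda>M. (xf - x0) / real M) \<longlonglongrightarrow> 0"
    by (rule lim_const_over_n)
  have nz: "Lt * wt + Lt * wt / (1 - 0 * Lt * wt) \<noteq> 0"
    using Lt_pos wt_ge_1 by auto
  have "(\<lambda>M. B ((xf - x0) / real M)) \<longlonglongrightarrow> B 0"
    unfolding B_def by (rule tendsto_intros h nz | simp)+
  moreover have "B 0 = 0" using m_pos by (simp add: B_def)
  ultimately have B: "(\<lambda>M. B ((xf - x0) / real M)) \<longlonglongrightarrow> 0" by simp
  have "(\<lambda>M. (xf - x0) / real M * Lt * wt) \<longlonglongrightarrow> 0 * Lt * wt"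
    by (intro tendsto_intros h)
  then have small: "\<forall>\<^sub>F M in sequentially. (xf - x0) / real M * Lt * wt < 1"
    by (rule order_tendstoD) simp
  show ?thesis
  proof (rule tendsto_sandwich[OF _ _ tendsto_const B])
    show "\<forall>\<^sub>F M in sequentially. 0 \<le> (MAX i\<in>{1..M}. node_error y
            (picard_method v f a b \<xi> m ((xf - x0) / real M) (n M) x0 (y x0) i))"
      using eventually_ge_at_top[of 1]
    proof eventually_elim
      case (elim M)
      have "0 \<le> node_error y (picard_method v f a b \<xi> m ((xf - x0) / real M) (n M) x0 (y x0) 1)"
        by (simp only: node_error_def infnorm_pos_le)
      then show ?case
        by (rule order.trans) (intro Max_ge finite_imageI finite_atLeastAtMost imageI; use elim in simp)
    qed
    show "\<forall>\<^sub>F M in sequentially. (MAX i\<in>{1..M}. node_error y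
            (picard_method v f a b \<xi> m ((xf - x0) / real M) (n M) x0 (y x0) i)) \<le> B ((xf - x0) / real M)"
      using small eventually_ge_at_top[of 1]
    proof eventually_elim
      case (elim M)
      then show ?case unfolding B_def by (intro picard_method_error n) auto
    qed
  qed
qed

end

section \<open>Convergence of the method\<close>

theorem mainTheorem1:
  fixes f :: "real \<Rightarrow> real^'N \<Rightarrow> real^'N"
    and y :: "real \<Rightarrow> real^'N" and y0 :: "real^'N"
    and x0 xf a b L Lt wt K Km :: real
    and \<xi> :: "nat \<Rightarrow> real" and m :: nat and v :: variant
  assumes interval: "x0 < xf"
    and f_cont: "continuous_on ({x0..xf} \<times> UNIV) (\<lambda>(x, z). f x z)"
    and L_pos: "L > 0"
    and f_lipschitz: "\<And>x z1 z2 \<mu>. x \<in> {x0..xf} \<Longrightarrow>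
          \<bar>f x z1 $ \<mu> - f x z2 $ \<mu>\<bar> \<le> L * (\<Sum>j\<in>UNIV. \<bar>z1 $ j - z2 $ j\<bar>)"
    and f_smooth: "C_partial m ({x0..xf} \<times> UNIV) (\<lambda>(x, z). f x z)"
    and y_ode: "\<And>x. x \<in> {x0..xf} \<Longrightarrow>
          (y has_vector_derivative f x (y x)) (at x within {x0..xf})"
    and y_init: "y x0 = y0"
    and m_pos: "m \<ge> 1"
    and ref_interval: "a < b"
    and nodes_mono: "strict_mono_on {1..m} \<xi>"
    and nodes_in: "\<xi> ` {1..m} \<subseteq> {a..b}"
    and K_pos: "K > 0"
    and K_bound: "\<And>\<mu> x. x \<in> {x0..xf} \<Longrightarrow> \<bar>f x (y x) $ \<mu>\<bar> \<le> K"
    and Km_pos: "Km > 0"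
    and Km_bound: "\<And>\<mu> x. x \<in> {x0..xf} \<Longrightarrow>
          \<bar>nth_deriv_on {x0..xf} m (\<lambda>s. f s (y s) $ \<mu>) x\<bar> \<le> Km"
    and Lt_eq: "Lt = real CARD('N) * L"
    and wt_eq: "wt = real m * max_weight a b \<xi> m"
  shows "(\<forall>M n h. M \<ge> 1 \<longrightarrow> (\<forall>i<M. n i \<ge> 1) \<longrightarrow> h = (xf - x0) / real M \<longrightarrow> h * Lt * wt < 1 \<longrightarrow>
            (MAX i\<in>{1..M}. node_error y (picard_method v f a b \<xi> m h n x0 y0 i))
              \<le> exp ((xf - x0) * Lt * wt * (1 + 1 / (1 - h * Lt * wt)))
                 * ((h * Lt * wt * K + Km * h ^ m / (fact m * (1 - h * Lt * wt)))
                    / (Lt * wt + Lt * wt / (1 - h * Lt * wt))))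
       \<and> (\<forall>n :: nat \<Rightarrow> nat \<Rightarrow> nat. (\<forall>M\<ge>1. \<forall>i<M. n M i \<ge> 1) \<longrightarrow>
            (\<lambda>M. MAX i\<in>{1..M}.
                node_error y (picard_method v f a b \<xi> m ((xf - x0) / real M) (n M) x0 y0 i))
              \<longlonglongrightarrow> 0)"
proof -
  interpret picard_ivp f y x0 xf a b L Lt wt K Km \<xi> m
    by unfold_locales (fact assms strict_mono_on_imp_inj_on[OF nodes_mono])+
  show ?thesis
    unfolding y_init[symmetric]
    by (intro conjI allI impI picard_method_error picard_method_converges) auto
qed

end
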